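(* Let $q$ be a prime power, $n,k$ positive integers, and $U$ a $k$-dimensional $\mathbb{F}_q$-subspace of $\mathbb{F}_{q^n}$. Then $U$ is a Sidon space if and only if the only points of $L_{U\times U}\subseteq\mathrm{PG}(1,q^n)=\mathrm{PG}(\mathbb{F}_{q^n}\times\mathbb{F}_{q^n},\mathbb{F}_{q^n})$ of weight greater than one are those in $L_{U\times U}\cap\mathrm{PG}(\mathbb{F}_q\times\mathbb{F}_q,\mathbb{F}_q)$, i.e. points $\langle(a,b)\rangle_{\mathbb{F}_{q^n}}$ with $(a,b)\in\mathbb{F}_q^2\setminus\{(0,0)\}$. Furthermore, the weight of such points is $k$. In particular, if $U$ is a Sidon space then $|L_{U\times U}|=\frac{q^k-1}{q-1}(q^k-q)+q+1$.
   Context: An $\mathbb{F}_q$-subspace $U$ of $\mathbb{F}_{q^n}$ is a Sidon space if for all nonzero $a,b,c,d\in U$, $ab=cd$ implies $\{a\mathbb{F}_q,b\mathbb{F}_q\}=\{c\mathbb{F}_q,d\mathbb{F}_q\}$, where $e\mathbb{F}_q=\{e\lambda:\lambda\in\mathbb{F}_q\}$. For an $\mathbb{F}_q$-subspace $W$ of $\mathbb{F}_{q^n}^2$, $L_W=\{\langle\mathbf{w}\rangle_{\mathbb{F}_{q^n}}:\mathbf{w}\in W\setminus\{\mathbf{0}\}\}\subseteq\mathrm{PG}(1,q^n)$, and the weight of a point $P=\langle\mathbf{v}\rangle_{\mathbb{F}_{q^n}}$ is $w_{L_W}(P)=\dim_{\mathbb{F}_q}(W\cap\langle\mathbf{v}\rangle_{\mathbb{F}_{q^n}})$.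 $U\times U=\{(a,b):a,b\in U\}$. *)

theory Defs
  imports "HOL-Library.Cardinality" "HOL-Analysis.Product_Vector" "HOL-Number_Theory.Prime_Powers"
begin

text \<open>
  The extension of \<open>\<F>\<^sub>q\<close> by \<open>\<F>\<^bsub>q^n\<^esub>\<close> is given by two finite field types
  \<open>'k\<close> and \<open>'a\<close> and an embedding \<open>\<iota> :: 'k \<Rightarrow> 'a\<close> (a unital ring homomorphism, hence
  injective); \<open>range \<iota>\<close> is \<open>\<F>\<^sub>q\<close> as a subfield of \<open>\<F>\<^bsub>q^n\<^esub>\<close>.  Subspaces, spans and
  dimensions over either field are those of \<^theory>\<open>HOL.Vector_Spaces\<close> for the scalar
  multiplications below.
\<close>

locale field_embedding =
  fixes \<iota> :: "'k::field \<Rightarrow> 'a::field"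
  assumes embed_one: "\<iota> 1 = 1"
    and embed_add: "\<iota> (x + y) = \<iota> x + \<iota> y"
    and embed_mult: "\<iota> (x * y) = \<iota> x * \<iota> y"

definition base_scale :: "('k::field \<Rightarrow> 'a::field) \<Rightarrow> 'k \<Rightarrow> 'a \<Rightarrow> 'a" where
  "base_scale \<iota> c x = \<iota> c * x"

abbreviation base_scale2 :: "('k::field \<Rightarrow> 'a::field) \<Rightarrow> 'k \<Rightarrow> 'a \<times> 'a \<Rightarrow> 'a \<times> 'a" where
  "base_scale2 \<iota> \<equiv> module_prod.scale (base_scale \<iota>) (base_scale \<iota>)"

abbreviation ext_scale2 :: "'a::field \<Rightarrow> 'a \<times> 'a \<Rightarrow> 'a \<times> 'a" where
  "ext_scale2 \<equiv> module_prod.scale (*) (*)"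

lemma (in field_embedding) vector_space_base: "vector_space (base_scale \<iota>)"
  by unfold_locales
    (simp_all add: base_scale_def embed_one embed_add embed_mult algebra_simps)

lemma (in field_embedding) vector_space_prod_base:
  "vector_space_prod (base_scale \<iota>) (base_scale \<iota>)"
  using vector_space_base by (simp add: vector_space_prod_def vector_space_pair_def)

lemma vector_space_prod_ext: "vector_space_prod ((*) :: 'a::field \<Rightarrow> _) (*)"
  by unfold_locales (simp_all add: algebra_simps)

definition base_multiples :: "('k::field \<Rightarrow> 'a::field) \<Rightarrow> 'a \<Rightarrow> 'a set" where
  "base_multiples \<iota> e = {e * \<iota> l | l. True}"

definition sidon_space :: "('k::field \<Rightarrow> 'a::field) \<Rightarrow> 'a set \<Rightarrow> bool" where
  "sidon_space \<iota> U \<longleftrightarrow>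
     module.subspace (base_scale \<iota>) U \<and>
     (\<forall>a\<in>U - {0}. \<forall>b\<in>U - {0}. \<forall>c\<in>U - {0}. \<forall>d\<in>U - {0}.
        a * b = c * d \<longrightarrow>
        {base_multiples \<iota> a, base_multiples \<iota> b} = {base_multiples \<iota> c, base_multiples \<iota> d})"

text \<open>
  A point of \<open>PG(1, q^n)\<close> is a one-dimensional \<open>'a\<close>-subspace of \<open>'a \<times> 'a\<close>, as a set of
  vectors including the zero vector.
\<close>

definition proj_point :: "'a::field \<times> 'a \<Rightarrow> ('a \<times> 'a) set" where
  "proj_point v = module.span ext_scale2 {v}"

definition linear_set :: "('a::field \<times> 'a) set \<Rightarrow> ('a \<times> 'a) set set" where
  "linear_set W = {proj_point w | w. w \<in> W - {0}}"

definition weight :: "('k::field \<Rightarrow> 'a::field) \<Rightarrow> ('a \<times> 'a) set \<Rightarrow> ('a \<times> 'a) set \<Rightarrow> nat" where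
  "weight \<iota> W P = vector_space.dim (base_scale2 \<iota>) (W \<inter> P)"

text \<open>\<open>PG(\<F>\<^sub>q \<times> \<F>\<^sub>q, \<F>\<^sub>q)\<close>, embedded in \<open>PG(1, q^n)\<close> as a canonical subline.\<close>

definition base_subline :: "('k::field \<Rightarrow> 'a::field) \<Rightarrow> ('a \<times> 'a) set set" where
  "base_subline \<iota> = {proj_point (\<iota> a, \<iota> b) | a b. (a, b) \<noteq> (0, 0)}"

end

theory Submission
  imports Defs
begin

text \<open>
  A relation \<open>a b = c d\<close> between nonzero elements of \<open>U\<close> says exactly that \<open>(a, c)\<close> and
  \<open>(d, b)\<close> span the same point of the projective line.  If these vectors are dependent over
  \<open>\<F>\<^sub>q\<close>, the relation is trivial with \<open>a\<close> proportional to \<open>d\<close>; otherwise the point has weight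
  at least two, and it lies on the canonical subline if and only if \<open>a\<close> is proportional to \<open>c\<close>.
  On the point of a nonzero \<open>(x, y)\<close> in \<open>\<F>\<^sub>q\<^sup>2\<close>, the set \<open>U \<times> U\<close> cuts out the vectors \<open>(u x, u y)\<close>
  with \<open>u \<in> U\<close>, so the weight is \<open>k\<close>.  The formula for the size of the linear set comes from
  sorting the \<open>q^(2k) - 1\<close> nonzero vectors of \<open>U \<times> U\<close> by the point they span.
\<close>

section \<open>Cardinalities of subspaces over a finite field\<close>

text \<open>Each new basis vector multiplies the cardinality by the number of scalars: a vector of
  \<open>span (insert b B)\<close> is \<open>c *s b + x\<close> with \<open>x\<close> in
  \<open>span B\<close> for exactly one pair \<open>(c, x)\<close>.\<close>

lemma (in vector_space) card_span_independent:
  assumes "finite B" "independent B" "finite (UNIV :: 'a set)"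
  shows "card (span B) = CARD('a) ^ card B"
  using assms(1,2)
proof (induction B)
  case empty
  then show ?case by simp
next
  case (insert b B)
  have ind: "independent B" and nb: "b \<notin> span B"
    using insert.prems insert.hyps by (simp_all add: independent_insert)
  define f where "f = (\<lambda>(c, x). c *s b + x)"
  have "inj_on f (UNIV \<times> span B)"
  proof (rule inj_onI, clarsimp simp: f_def)
    fix c x d y
    assume xy: "x \<in> span B" "y \<in> span B" and eq: "c *s b + x = d *s b + y"
    have "(c - d) *s b = y - x"
      using eq by (simp add: scale_left_diff_distrib algebra_simps)
    then have "(c - d) *s b \<in> span B"
      using xy by (simp add: span_diff)
    \<comment> \<open>If \<open>c - d\<close> were nonzero, dividing by it would put
      \<open>b\<close> into \<open>span B\<close>.\<close>
    then have "c = d"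
      using nb span_scale[of "(c - d) *s b" B "inverse (c - d)"] by (cases "c = d") auto
    then show "c = d \<and> x = y" using eq by simp
  qed
  moreover have "f ` (UNIV \<times> span B) = span (insert b B)"
  proof (intro equalityI subsetI)
    fix x assume "x \<in> span (insert b B)"
    then obtain c where "x - c *s b \<in> span B"
      by (auto simp: span_breakdown_eq)
    then show "x \<in> f ` (UNIV \<times> span B)"
      by (intro image_eqI[of _ _ "(c, x - c *s b)"]) (auto simp: f_def)
  next
    fix x assume "x \<in> f ` (UNIV \<times> span B)"
    then obtain c y where "y \<in> span B" "x = c *s b + y"
      by (auto simp: f_def)
    then have "x - c *s b \<in> span B" by simp
    then show "x \<in> span (insert b B)"
      unfolding span_breakdown_eq by blast
  qed
  ultimately have "card (span (insert b B)) = card ((UNIV :: 'a set) \<times> span B)"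
    using card_image by fastforce
  also have "\<dots> = CARD('a) ^ card (insert b B)"
    using insert.IH[OF ind] insert.hyps by (simp add: card_cartesian_product)
  finally show ?case .
qed

lemma (in vector_space) card_subspace:
  assumes "subspace S" "finite S" "finite (UNIV :: 'a set)"
  shows "card S = CARD('a) ^ dim S"
proof -
  obtain B where B: "B \<subseteq> S" "independent B" "S \<subseteq> span B" "card B = dim S"
    using basis_exists by blast
  have "span B = S" using B assms(1) span_minimal by blast
  moreover have "finite B" using B assms(2) finite_subset by blast
  ultimately show ?thesis
    using card_span_independent[of B] B assms(3) by simp
qed

lemma one_less_card_field: "1 < CARD('a::{field, finite})"
  using card_mono[of UNIV "{0, 1 :: 'a}"] by simp

section \<open>Points of the projective line over the extension field\<close>

lemma ext_scale2_eq: "ext_scale2 c v = (c * fst v, c * snd v)"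
proof -
  interpret vector_space_prod "(*) :: 'a::field \<Rightarrow> _" "(*) :: 'a \<Rightarrow> _"
    by (rule vector_space_prod_ext)
  show ?thesis by (simp add: scale_def)
qed

lemma proj_point_eq: "proj_point v = range (\<lambda>c. (c * fst v, c * snd v))"
proof -
  interpret vector_space_prod "(*) :: 'a::field \<Rightarrow> _" "(*) :: 'a \<Rightarrow> _"
    by (rule vector_space_prod_ext)
  show ?thesis
    by (simp add: proj_point_def p.span_singleton ext_scale2_eq)
qed

lemma mem_proj_point_iff: "w \<in> proj_point v \<longleftrightarrow> (\<exists>c. w = (c * fst v, c * snd v))"
  by (auto simp: proj_point_eq)

text \<open>The scalar taking \<open>v\<close> to \<open>w\<close> is nonzero, hence invertible.
  Distinct points therefore share only the zero vector.\<close>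

lemma proj_point_eqI:
  assumes "w \<in> proj_point v" "w \<noteq> 0"
  shows "proj_point w = proj_point v"
proof -
  obtain c where w: "w = (c * fst v, c * snd v)"
    using assms(1) by (auto simp: mem_proj_point_iff)
  then have "c \<noteq> 0" using assms(2) by (auto simp: zero_prod_def)
  have "proj_point w \<subseteq> proj_point v"
    by (auto simp: proj_point_eq w intro!: rev_image_eqI[of "_ * c"])
  moreover have "proj_point v \<subseteq> proj_point w"
    using \<open>c \<noteq> 0\<close> by (auto simp: proj_point_eq w intro!: rev_image_eqI[of "_ / c"])
  ultimately show ?thesis by blast
qed

lemma proj_point_self: "v \<in> proj_point v"
  by (auto simp: mem_proj_point_iff intro: exI[of _ 1])

text \<open>The points partition the nonzero vectors of \<open>W\<close>; zero is removed because it
  lies on every point.\<close>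

lemma card_eq_sum_linear_set:
  fixes W :: "('a::{field, finite} \<times> 'a) set"
  shows "card (W - {0}) = (\<Sum>P\<in>linear_set W. card (W \<inter> P - {0}))"
proof -
  have "W - {0} = (\<Union>P\<in>linear_set W. W \<inter> P - {0})"
    by (auto simp: linear_set_def intro: proj_point_self)
  moreover have "(W \<inter> P - {0}) \<inter> (W \<inter> Q - {0}) = {}"
    if "P \<in> linear_set W" "Q \<in> linear_set W" "P \<noteq> Q" for P Q
    using that by (auto simp: linear_set_def dest: proj_point_eqI)
  ultimately show ?thesis
    using card_UN_disjoint[of "linear_set W" "\<lambda>P. W \<inter> P - {0}"] by simp
qed

section \<open>The embedded base field and the canonical subline\<close>

context field_embedding
begin

lemma embed_zero: "\<iota> 0 = 0"
  using embed_add[of 0 0] by (metis add.right_neutral add_left_cancel)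

lemma embed_inverse: "x \<noteq> 0 \<Longrightarrow> \<iota> (inverse x) * \<iota> x = 1"
  by (metis embed_mult embed_one left_inverse)

lemma embed_eq_0_iff: "\<iota> x = 0 \<longleftrightarrow> x = 0"
  using embed_inverse[of x] embed_zero by (cases "x = 0") auto

lemma inj_embed: "inj \<iota>"
proof (rule injI)
  fix x y assume "\<iota> x = \<iota> y"
  moreover have "\<iota> x = \<iota> (x - y) + \<iota> y" by (simp flip: embed_add)
  ultimately show "x = y" by (simp add: embed_eq_0_iff)
qed

lemma base_multiples_eq_iff:
  assumes "b \<noteq> 0"
  shows "base_multiples \<iota> a = base_multiples \<iota> b \<longleftrightarrow> (\<exists>l. l \<noteq> 0 \<and> a = b * \<iota> l)"
proof
  assume "base_multiples \<iota> a = base_multiples \<iota> b"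
  moreover have "a \<in> base_multiples \<iota> a" "b \<in> base_multiples \<iota> b"
    unfolding base_multiples_def by (auto intro!: exI[of _ 1] simp: embed_one)
  ultimately obtain l m where "a = b * \<iota> l" "b = a * \<iota> m"
    unfolding base_multiples_def by blast
  \<comment> \<open>With \<open>l = 0\<close>, both \<open>a\<close> and then
    \<open>b = a * \<iota> m\<close> would vanish.\<close>
  moreover from this have "l \<noteq> 0"
    using assms embed_zero by (metis mult_zero_left mult_zero_right)
  ultimately show "\<exists>l. l \<noteq> 0 \<and> a = b * \<iota> l" by blast
next
  assume "\<exists>l. l \<noteq> 0 \<and> a = b * \<iota> l"
  then obtain l where l: "l \<noteq> 0" "a = b * \<iota> l" by blast
  have "b * \<iota> m = a * \<iota> (m / l)" for m
    using l embed_inverse[of l]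
    by (simp add: divide_inverse embed_mult) (simp add: mult_ac)
  moreover have "a * \<iota> m = b * \<iota> (l * m)" for m
    using l by (simp add: embed_mult mult_ac)
  ultimately show "base_multiples \<iota> a = base_multiples \<iota> b"
    unfolding base_multiples_def by blast
qed

lemma subspace_base_iff:
  "module.subspace (base_scale \<iota>) U \<longleftrightarrow>
     0 \<in> U \<and> (\<forall>x\<in>U. \<forall>y\<in>U. x + y \<in> U) \<and> (\<forall>l. \<forall>x\<in>U. \<iota> l * x \<in> U)"
proof -
  interpret vector_space "base_scale \<iota>" by (rule vector_space_base)
  show ?thesis by (auto simp: subspace_def base_scale_def)
qed

lemma subspace_range: "module.subspace (base_scale \<iota>) (range \<iota>)"
proof -
  have "0 \<in> range \<iota>" using embed_zero by (metis rangeI)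
  then show ?thesis
    by (auto simp: subspace_base_iff simp flip: embed_add embed_mult)
qed

lemma base_scale2_eq: "base_scale2 \<iota> c v = (\<iota> c * fst v, \<iota> c * snd v)"
proof -
  interpret vector_space_prod "base_scale \<iota>" "base_scale \<iota>"
    by (rule vector_space_prod_base)
  show ?thesis by (simp add: scale_def base_scale_def)
qed

lemma base_subline_eq: "base_subline \<iota> = linear_set (range \<iota> \<times> range \<iota>)"
proof -
  have "(\<iota> a, \<iota> b) = 0 \<longleftrightarrow> (a, b) = (0, 0)" for a b
    by (simp add: zero_prod_def embed_eq_0_iff)
  then show ?thesis
    unfolding base_subline_def linear_set_def by blast
qed

text \<open>The vector \<open>(a, b)\<close> is \<open>b\<close> times
  \<open>(\<iota> l, 1)\<close>. Together with the elimination rule below, this detects subline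
  points with nonzero coordinates by their ratio.\<close>

lemma proj_point_mem_base_sublineI:
  assumes "l \<noteq> 0" "b \<noteq> 0" "a = b * \<iota> l"
  shows "proj_point (a, b) \<in> base_subline \<iota>"
proof -
  have "proj_point (a, b) = proj_point (\<iota> l, \<iota> 1)"
    using assms by (intro proj_point_eqI)
      (auto simp: mem_proj_point_iff zero_prod_def embed_one)
  then show ?thesis unfolding base_subline_def using assms(1) by blast
qed

lemma proj_point_mem_base_sublineE:
  assumes "proj_point (a, b) \<in> base_subline \<iota>" "a \<noteq> 0" "b \<noteq> 0"
  obtains l where "l \<noteq> 0" "a = b * \<iota> l"
proof -
  obtain x y where "proj_point (a, b) = proj_point (\<iota> x, \<iota> y)"
    using assms(1) by (auto simp: base_subline_def)
  then obtain c where c: "a = c * \<iota> x" "b = c * \<iota> y"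
    using proj_point_self[of "(a, b)"] by (auto simp: mem_proj_point_iff)
  then have "x \<noteq> 0" "y \<noteq> 0"
    using assms(2,3) embed_zero by auto
  then have "a = b * \<iota> (x / y)"
    using c embed_inverse[of y]
    by (simp add: divide_inverse embed_mult) (simp add: mult_ac)
  with \<open>x \<noteq> 0\<close> \<open>y \<noteq> 0\<close> that[of "x / y"] show thesis by simp
qed

text \<open>One of \<open>x\<close>, \<open>y\<close> is nonzero, and multiplying the corresponding
  coordinate by its inverse in the base field recovers the factor \<open>c\<close> inside
  \<open>U\<close>.\<close>

lemma base_point_meets:
  assumes "module.subspace (base_scale \<iota>) U" "(x, y) \<noteq> (0, 0)"
  shows "U \<times> U \<inter> proj_point (\<iota> x, \<iota> y) = (\<lambda>u. (u * \<iota> x, u * \<iota> y)) ` U"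
proof -
  have sc: "\<iota> l * u \<in> U" if "u \<in> U" for l u
    using assms(1) that by (auto simp: subspace_base_iff)
  have "c \<in> U" if c: "c * \<iota> x \<in> U" "c * \<iota> y \<in> U" for c
  proof -
    obtain z where "z \<noteq> 0" "c * \<iota> z \<in> U"
      using c assms(2) by (cases "x = 0") auto
    then have "\<iota> (inverse z) * (c * \<iota> z) \<in> U" using sc by blast
    moreover have "\<iota> (inverse z) * (c * \<iota> z) = c"
      using embed_inverse[OF \<open>z \<noteq> 0\<close>] by (simp add: mult.left_commute)
    ultimately show ?thesis by simp
  qed
  moreover have "u * \<iota> l \<in> U" if "u \<in> U" for l u
    using sc[OF that, of l] by (simp add: mult.commute)
  ultimately show ?thesis
    unfolding proj_point_eq fst_conv snd_conv by blast
qed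

lemma card_base_point_meets:
  assumes "module.subspace (base_scale \<iota>) U" "P \<in> base_subline \<iota>"
  shows "card (U \<times> U \<inter> P) = card U"
proof -
  obtain x y where P: "P = proj_point (\<iota> x, \<iota> y)" and xy: "(x, y) \<noteq> (0, 0)"
    using assms(2) by (auto simp: base_subline_def)
  have "inj_on (\<lambda>u. (u * \<iota> x, u * \<iota> y)) U"
    using xy by (auto simp: inj_on_def embed_eq_0_iff)
  then show ?thesis
    using base_point_meets[OF assms(1) xy] by (simp add: P card_image)
qed

text \<open>Any nonzero \<open>u\<close> in \<open>U\<close> gives the nonzero vector
  \<open>(u * \<iota> x, u * \<iota> y)\<close> of \<open>U \<times> U\<close> on the point.\<close>

lemma base_subline_subset_linear_set:
  assumes "module.subspace (base_scale \<iota>) U" "U \<noteq> {0}"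
  shows "base_subline \<iota> \<subseteq> linear_set (U \<times> U)"
proof
  fix P assume "P \<in> base_subline \<iota>"
  then obtain x y where P: "P = proj_point (\<iota> x, \<iota> y)" and xy: "(x, y) \<noteq> (0, 0)"
    by (auto simp: base_subline_def)
  obtain u where u: "u \<in> U" "u \<noteq> 0"
    using assms by (auto simp: subspace_base_iff)
  let ?w = "(u * \<iota> x, u * \<iota> y)"
  have "?w \<in> U \<times> U \<inter> P"
    using base_point_meets[OF assms(1) xy] u by (auto simp: P)
  moreover have "?w \<noteq> 0"
    using u xy by (auto simp: zero_prod_def embed_eq_0_iff)
  ultimately show "P \<in> linear_set (U \<times> U)"
    using proj_point_eqI[of ?w "(\<iota> x, \<iota> y)"] by (auto simp: P linear_set_def)
qed

end

section \<open>Weights expressed by cardinalities, and the Sidon criterion\<close>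

lemma card_inter_proj_point:
  fixes \<iota> :: "'k::{field, finite} \<Rightarrow> 'a::{field, finite}"
  assumes "field_embedding \<iota>" "module.subspace (base_scale \<iota>) U"
  shows "card (U \<times> U \<inter> proj_point v) = CARD('k) ^ weight \<iota> (U \<times> U) (proj_point v)"
proof -
  interpret field_embedding \<iota> by fact
  interpret vector_space_prod "base_scale \<iota>" "base_scale \<iota>"
    by (rule vector_space_prod_base)
  \<comment> \<open>Explicit factors showing that the multiples of a vector are closed under
    addition and scaling.\<close>
  have "\<exists>d. (c * x + c' * x, c * y + c' * y) = (d * x, d * y)" for c c' x y :: 'a
    by (intro exI[of _ "c + c'"]) (simp add: distrib_right)
  moreover have "\<exists>d. (e * (c * x), e * (c * y)) = (d * x, d * y)" for e c x y :: 'a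
    by (intro exI[of _ "e * c"]) simp
  ultimately have "p.subspace (U \<times> U \<inter> proj_point v)"
    using assms(2)
    by (auto simp: p.subspace_def base_scale2_eq subspace_base_iff mem_proj_point_iff zero_prod_def)
  then show ?thesis
    unfolding weight_def by (rule p.card_subspace) simp_all
qed

text \<open>A nonzero vector has \<open>CARD('k)\<close> multiples over the base field, so weight
  above one means that the point carries some further vector of \<open>U \<times> U\<close>.\<close>

lemma one_less_weight_iff:
  fixes \<iota> :: "'k::{field, finite} \<Rightarrow> 'a::{field, finite}"
  assumes "field_embedding \<iota>" "module.subspace (base_scale \<iota>) U"
  shows "weight \<iota> (U \<times> U) (proj_point v) > 1 \<longleftrightarrow> card (U \<times> U \<inter> proj_point v) > CARD('k)"
proof -
  have "CARD('k) > 1" by (rule one_less_card_field)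
  then have "CARD('k) ^ 1 < CARD('k) ^ m \<longleftrightarrow> 1 < m" for m
    by (rule power_strict_increasing_iff)
  then show ?thesis by (simp add: card_inter_proj_point[OF assms])
qed

lemma sidon_space_iff:
  fixes \<iota> :: "'k::{field, finite} \<Rightarrow> 'a::{field, finite}"
  assumes "field_embedding \<iota>" "module.subspace (base_scale \<iota>) U"
  shows "sidon_space \<iota> U \<longleftrightarrow>
    (\<forall>P\<in>linear_set (U \<times> U). weight \<iota> (U \<times> U) P > 1 \<longrightarrow> P \<in> base_subline \<iota>)"
proof
  interpret field_embedding \<iota> by fact
  assume S: "sidon_space \<iota> U"
  show "\<forall>P\<in>linear_set (U \<times> U). weight \<iota> (U \<times> U) P > 1 \<longrightarrow> P \<in> base_subline \<iota>"
  proof (intro ballI impI)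
    fix P assume "P \<in> linear_set (U \<times> U)" and w: "weight \<iota> (U \<times> U) P > 1"
    then obtain a b where P: "P = proj_point (a, b)" and ab: "a \<in> U" "b \<in> U" "(a, b) \<noteq> 0"
      by (auto simp: linear_set_def)
    \<comment> \<open>By counting, some vector \<open>(c * a, c * b)\<close> of
      \<open>U \<times> U\<close> escapes \<open>?M\<close>, so its factor \<open>c\<close> lies
      outside the base field.\<close>
    let ?M = "range (\<lambda>l. (\<iota> l * a, \<iota> l * b))"
    have "card ?M \<le> CARD('k)" by (rule card_image_le) simp
    also have "\<dots> < card (U \<times> U \<inter> P)"
      using w one_less_weight_iff[OF assms] by (simp add: P)
    finally have "\<not> U \<times> U \<inter> P \<subseteq> ?M"
      using card_mono[of ?M "U \<times> U \<inter> P"] by auto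
    then obtain w where "w \<in> U \<times> U" "w \<in> P" "w \<notin> ?M" by blast
    moreover from \<open>w \<in> P\<close> obtain c where "w = (c * a, c * b)"
      by (auto simp: P mem_proj_point_iff)
    ultimately have c: "c * a \<in> U" "c * b \<in> U" "(c * a, c * b) \<notin> ?M" by simp_all
    then have cr: "c \<notin> range \<iota>" by auto
    then have c0: "c \<noteq> 0" using embed_zero by (metis rangeI)
    show "P \<in> base_subline \<iota>"
    \<comment> \<open>The Sidon condition concerns nonzero elements only; a zero coordinate leaves
      just the points of (1, 0) and (0, 1), both on the subline.\<close>
    proof (cases "a = 0 \<or> b = 0")
      case True
      have "proj_point (a, 0) = proj_point (\<iota> 1, \<iota> 0)" if "a \<noteq> 0"
        using that by (intro proj_point_eqI)
            (auto simp: mem_proj_point_iff zero_prod_def embed_one embed_zero)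
      moreover have "proj_point (0, b) = proj_point (\<iota> 0, \<iota> 1)" if "b \<noteq> 0"
        using that by (intro proj_point_eqI)
            (auto simp: mem_proj_point_iff zero_prod_def embed_one embed_zero)
      moreover have "(1 :: 'k, 0 :: 'k) \<noteq> (0, 0)" "(0 :: 'k, 1 :: 'k) \<noteq> (0, 0)" by auto
      ultimately show ?thesis
        using True ab(3) unfolding P base_subline_def zero_prod_def by blast
    next
      case False
      \<comment> \<open>The Sidon condition for this product makes \<open>a\<close> proportional
        either to \<open>b\<close>, giving a subline point, or to \<open>c * a\<close>, which is
        impossible as \<open>c\<close> is not in the base field.\<close>
      have "a * (c * b) = b * (c * a)" by (simp add: mult_ac)
      then have "{base_multiples \<iota> a, base_multiples \<iota> (c * b)} =
          {base_multiples \<iota> b, base_multiples \<iota> (c * a)}"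
        using S ab c c0 False unfolding sidon_space_def by auto
      then consider "base_multiples \<iota> a = base_multiples \<iota> b"
        | "base_multiples \<iota> (c * a) = base_multiples \<iota> a"
        by (auto simp: doubleton_eq_iff)
      then show ?thesis
      proof cases
        case 1
        then show ?thesis
          using False proj_point_mem_base_sublineI by (auto simp: P base_multiples_eq_iff)
      next
        case 2
        then show ?thesis
          using False cr by (auto simp: base_multiples_eq_iff)
      qed
    qed
  qed
next
  interpret field_embedding \<iota> by fact
  assume R: "\<forall>P\<in>linear_set (U \<times> U). weight \<iota> (U \<times> U) P > 1 \<longrightarrow> P \<in> base_subline \<iota>"
  have "{base_multiples \<iota> a, base_multiples \<iota> b} = {base_multiples \<iota> c, base_multiples \<iota> d}"
    if U: "a \<in> U" "b \<in> U" "c \<in> U" "d \<in> U"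
      and nz: "a \<noteq> 0" "b \<noteq> 0" "c \<noteq> 0" "d \<noteq> 0" and eq: "a * b = c * d" for a b c d
  proof (cases "base_multiples \<iota> d = base_multiples \<iota> a")
    case True
    then obtain l where l: "l \<noteq> 0" "d = a * \<iota> l"
      using nz by (auto simp: base_multiples_eq_iff)
    then have "b = c * \<iota> l" using eq nz(1) by (simp add: mult.left_commute)
    then have "base_multiples \<iota> b = base_multiples \<iota> c"
      using l nz by (auto simp: base_multiples_eq_iff)
    with True show ?thesis by auto
  next
    case False
    let ?P = "proj_point (a, c)"
    let ?M = "range (\<lambda>l. (\<iota> l * a, \<iota> l * c))"
    \<comment> \<open>The relation \<open>a * b = c * d\<close> says that \<open>(d, b)\<close> is
      \<open>d / a\<close> times \<open>(a, c)\<close>. As \<open>d\<close> is not a base multiple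
      of \<open>a\<close>, this vector lies outside \<open>?M\<close>, which forces weight above
      one.\<close>
    have "(d, b) \<in> ?P"
      using eq nz by (auto simp: mem_proj_point_iff field_simps intro!: exI[of _ "d / a"])
    moreover have "?M \<subseteq> U \<times> U \<inter> ?P"
      using assms(2) U by (auto simp: subspace_base_iff mem_proj_point_iff)
    moreover have "(d, b) \<notin> ?M"
    proof
      assume "(d, b) \<in> ?M"
      then obtain l where l: "d = a * \<iota> l" by (auto simp: mult.commute)
      then have "l \<noteq> 0" using nz embed_zero by auto
      with l False nz show False by (auto simp: base_multiples_eq_iff)
    qed
    ultimately have "?M \<subset> U \<times> U \<inter> ?P" using U by blast
    then have "card ?M < card (U \<times> U \<inter> ?P)" by (rule psubset_card_mono[rotated]) simp
    moreover have "card ?M = CARD('k)"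
      using nz inj_embed by (intro card_image) (auto simp: inj_on_def)
    moreover have "?P \<in> linear_set (U \<times> U)"
      using U nz by (auto simp: linear_set_def zero_prod_def)
    ultimately have "?P \<in> base_subline \<iota>"
      using R one_less_weight_iff[OF assms] by simp
    then obtain l where l: "l \<noteq> 0" "a = c * \<iota> l"
      using nz by (elim proj_point_mem_base_sublineE)
    \<comment> \<open>Substituting \<open>a = c * \<iota> l\<close> into
      \<open>a * b = c * d\<close> and cancelling \<open>c\<close>.\<close>
    then have "d = b * \<iota> l"
      using eq nz(3) by (simp add: mult_ac)
    with l have "base_multiples \<iota> a = base_multiples \<iota> c"
      "base_multiples \<iota> d = base_multiples \<iota> b"
      using nz by (auto simp: base_multiples_eq_iff)
    then show ?thesis by simp
  qed
  then show "sidon_space \<iota> U"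
    using assms(2) unfolding sidon_space_def by blast
qed

section \<open>Sizes of the subline and of the linear set\<close>

text \<open>
  The subline is itself the linear set of \<open>\<F>\<^sub>q \<times> \<F>\<^sub>q\<close>, so its size follows from the same count,
  with \<open>U = \<F>\<^sub>q\<close>.
\<close>

lemma card_base_subline:
  fixes \<iota> :: "'k::{field, finite} \<Rightarrow> 'a::{field, finite}"
  assumes "field_embedding \<iota>"
  shows "card (base_subline \<iota>) = CARD('k) + 1"
proof -
  interpret field_embedding \<iota> by fact
  let ?F = "range \<iota>"
  have q: "CARD('k) > 1" by (rule one_less_card_field)
  have card_F: "card ?F = CARD('k)" by (rule card_image[OF inj_embed])
  have 0: "0 \<in> ?F" using subspace_range by (simp add: subspace_base_iff)
  have "CARD('k) * CARD('k) - 1 = card (?F \<times> ?F - {0})"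
    using 0 by (simp add: card_F card_cartesian_product zero_prod_def)
  also have "\<dots> = (\<Sum>P\<in>base_subline \<iota>. card (?F \<times> ?F \<inter> P - {0}))"
    using card_eq_sum_linear_set[of "?F \<times> ?F"] by (simp add: base_subline_eq)
  also have "\<dots> = (\<Sum>P\<in>base_subline \<iota>. CARD('k) - 1)"
  proof (rule sum.cong)
    fix P assume P: "P \<in> base_subline \<iota>"
    then have "0 \<in> ?F \<times> ?F \<inter> P"
      using 0 by (auto simp: base_subline_def mem_proj_point_iff zero_prod_def intro: exI[of _ 0])
    then show "card (?F \<times> ?F \<inter> P - {0}) = CARD('k) - 1"
      using card_base_point_meets[OF subspace_range P] by (simp add: card_F)
  qed simp
  also have "\<dots> = card (base_subline \<iota>) * (CARD('k) - 1)" by simp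
  \<comment> \<open>The left side of the count is a difference of squares;
    \<open>CARD('k) - 1\<close> is positive and cancels.\<close>
  finally have "(CARD('k) + 1) * (CARD('k) - 1) = card (base_subline \<iota>) * (CARD('k) - 1)"
    by (simp add: add_mult_distrib diff_mult_distrib2)
  then show ?thesis using q by (subst (asm) mult_cancel2) simp
qed

text \<open>Subline points carry \<open>u - 1\<close> nonzero vectors each and all other points
  \<open>q - 1\<close>; the resulting equation for \<open>u * u - 1\<close> is solved for the number
  of points. Working in the reals permits division by \<open>q - 1\<close>.\<close>

lemma card_linear_set_sidon:
  fixes \<iota> :: "'k::{field, finite} \<Rightarrow> 'a::{field, finite}"
  assumes \<iota>: "field_embedding \<iota>" and sub: "module.subspace (base_scale \<iota>) U"
    and U0: "U \<noteq> {0}" and S: "sidon_space \<iota> U"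
  defines "q \<equiv> real CARD('k)" and "u \<equiv> real (card U)"
  shows "real (card (linear_set (U \<times> U))) = (u - 1) / (q - 1) * (u - q) + q + 1"
proof -
  interpret field_embedding \<iota> by fact
  let ?L = "linear_set (U \<times> U)" and ?B = "base_subline \<iota>"
  have q: "q > 1" using one_less_card_field[where 'a = 'k] by (simp add: q_def)
  have BL: "?B \<subseteq> ?L" by (rule base_subline_subset_linear_set[OF sub U0])
  have 0: "0 \<in> U" using sub by (simp add: subspace_base_iff)
  have zero: "0 \<in> U \<times> U \<inter> P" if "P \<in> ?L" for P
    using that 0 by (auto simp: linear_set_def mem_proj_point_iff zero_prod_def intro: exI[of _ 0])
  have card_minus: "real (card (A - {0})) = real (card A) - 1"
    if "0 \<in> A" for A :: "('a \<times> 'a) set"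
    using that card_gt_0_iff[of A] by (subst card_Diff_singleton) (auto simp: of_nat_diff Suc_le_eq)
  have base: "real (card (U \<times> U \<inter> P - {0})) = u - 1" if "P \<in> ?B" for P
    using that BL card_minus[OF zero, of P] card_base_point_meets[OF sub that]
    by (auto simp: u_def)
  \<comment> \<open>Off the subline, the Sidon property bounds the weight by one, while the spanning
    vector \<open>v\<close> excludes weight zero.\<close>
  have other: "real (card (U \<times> U \<inter> P - {0})) = q - 1" if mem: "P \<in> ?L - ?B" for P
  proof -
    obtain v where P: "P = proj_point v" and v: "v \<in> U \<times> U" "v \<noteq> 0"
      using mem unfolding linear_set_def by blast
    have card: "card (U \<times> U \<inter> P) = CARD('k) ^ weight \<iota> (U \<times> U) P"
      using card_inter_proj_point[OF \<iota> sub] by (simp add: P)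
    \<comment> \<open>Two distinct vectors on the point rule out cardinality
      \<open>CARD('k) ^ 0 = 1\<close>.\<close>
    have "{0, v} \<subseteq> U \<times> U \<inter> P"
      using zero[of P] mem v proj_point_self[of v] by (simp add: P)
    then have "card {0, v} \<le> card (U \<times> U \<inter> P)" by (intro card_mono) simp_all
    then have "weight \<iota> (U \<times> U) P \<noteq> 0" using v card by (intro notI) simp
    moreover have "\<not> weight \<iota> (U \<times> U) P > 1"
      using S mem sidon_space_iff[OF \<iota> sub] by auto
    ultimately have "weight \<iota> (U \<times> U) P = 1" by simp
    with card card_minus[OF zero, of P] mem show ?thesis by (simp add: q_def)
  qed
  have "u * u - 1 = real (card (U \<times> U - {0}))"
    using 0 by (subst card_minus) (simp_all add: u_def card_cartesian_product zero_prod_def)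
  also have "\<dots> = (\<Sum>P\<in>?L. real (card (U \<times> U \<inter> P - {0})))"
    by (simp add: card_eq_sum_linear_set[of "U \<times> U"])
  also have "\<dots> = (\<Sum>P\<in>?L - ?B. real (card (U \<times> U \<inter> P - {0}))) +
      (\<Sum>P\<in>?B. real (card (U \<times> U \<inter> P - {0})))"
    by (rule sum.subset_diff[OF BL]) simp
  also have "\<dots> = (real (card ?L) - (q + 1)) * (q - 1) + (q + 1) * (u - 1)"
    using BL card_mono[OF _ BL]
    by (simp add: base other card_Diff_subset of_nat_diff card_base_subline[OF \<iota>] q_def
        add.commute)
  finally show ?thesis
    using q by (simp add: field_simps)
qed

theorem theorem6p1:
  fixes \<iota> :: "'k::{field, finite} \<Rightarrow> 'a::{field, finite}"
    and q n k :: nat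
    and U :: "'a set"
  assumes "primepow q" and "n > 0" and "k > 0"
    and "CARD('k) = q" and "CARD('a) = q ^ n"
    and "field_embedding \<iota>"
    and "module.subspace (base_scale \<iota>) U"
    and "vector_space.dim (base_scale \<iota>) U = k"
  shows "(sidon_space \<iota> U \<longleftrightarrow>
            (\<forall>P\<in>linear_set (U \<times> U).
               weight \<iota> (U \<times> U) P > 1 \<longrightarrow> P \<in> linear_set (U \<times> U) \<inter> base_subline \<iota>))
       \<and> (\<forall>P\<in>base_subline \<iota>. P \<in> linear_set (U \<times> U) \<and> weight \<iota> (U \<times> U) P = k)
       \<and> (sidon_space \<iota> U \<longrightarrow>
            real (card (linear_set (U \<times> U))) =
              (real q ^ k - 1) / (real q - 1) * (real q ^ k - real q) + real q + 1)"
proof -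
  interpret field_embedding \<iota> by fact
  interpret V: vector_space "base_scale \<iota>" by (rule vector_space_base)
  note sub = assms(7)
  have q: "q > 1" using one_less_card_field[where 'a = 'k] assms(4) by simp
  have card_U: "card U = q ^ k"
    using V.card_subspace[OF sub] assms(4,8) by simp
  \<comment> \<open>Since \<open>k > 0\<close>, the cardinality \<open>q ^ k\<close> exceeds
    one.\<close>
  have "U \<noteq> {0}"
    using card_U q \<open>k > 0\<close> one_less_power[of q k] by auto
  note U0 = base_subline_subset_linear_set[OF sub this] card_linear_set_sidon[OF assms(6) sub this]
  have "weight \<iota> (U \<times> U) P = k" if P: "P \<in> base_subline \<iota>" for P
  proof -
    obtain v where "P = proj_point v" using P by (auto simp: base_subline_def)
    \<comment> \<open>Both sides count \<open>U \<times> U \<inter> P\<close>; powers of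
      \<open>q > 1\<close> determine their exponents.\<close>
    then have "q ^ weight \<iota> (U \<times> U) P = q ^ k"
      using card_inter_proj_point[OF assms(6) sub] card_base_point_meets[OF sub P] card_U assms(4)
      by simp
    then show ?thesis using q by simp
  qed
  then show ?thesis
    using U0 sidon_space_iff[OF assms(6) sub] card_U assms(4) by auto
qed

end
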